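(* Let $S$ be a random variable satisfying $\mathsf{supp}\,S\subseteq[0,1]$ and $\mathbb{E}[S]=\mathbf{h}^{\mathsf T}\boldsymbol{\alpha}$. Then the following claims are equivalent: (1) $S$ is $(\mathbf{h},\boldsymbol{\alpha})$-decomposable; (2) for each $k\in\{1,\dots,n-1\}$, $\pi_S(\mathsf{H}_{[k]})\le (1-\mathsf{H}_{[k]})\bar\alpha_k$; (3) $S\le_{\mathrm{cx}}\bar S_{\mathbf{h},\boldsymbol{\alpha}}$; (4) $S$ is comonotonically $(\mathbf{h},\boldsymbol{\alpha})$-decomposable.
   Context: Let $n\ge 2$ be an integer, $\mathbf{h}=(h_1,\dots,h_n)^{\mathsf T}$ with $h_k>0$ and $\sum_{k=1}^n h_k=1$, and $\boldsymbol{\alpha}=(\alpha_1,\dots,\alpha_n)^{\mathsf T}$ with $1\ge\alpha_1>\alpha_2>\cdots>\alpha_n>0$ and $\alpha_n\le \tfrac12$. Put $\mathsf{H}_{[0]}=0$, $\mathsf{H}_{[k]}=\sum_{i=1}^k h_i$, and $\bar\alpha_k=\frac{\sum_{i=k+1}^n h_i\alpha_i}{1-\mathsf{H}_{[k]}}$ for $0\le k\le n-1$. $\mathsf{supp}\,X\subseteq A$ means $X\in A$ almost surely. For a random variable $X$ with $\mathsf{supp}\,X\subseteq[0,1]$ and cumulative distribution function $F_X$, the stop-loss transform is $\pi_X(t)=\int_t^1(1-F_X(x))\,dx=\mathbb{E}[(X-t)_+]$, $t\in[0,1]$, where $(a)_+=\max\{a,0\}$; the quantile function is $Q_X(p)=\inf\{x\in[0,1]:p\le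 F_X(x)\}$, $p\in(0,1]$. $S$ is $(\mathbf{h},\boldsymbol{\alpha})$-decomposable if there is a random vector $\mathbf{W}$ with $\mathsf{supp}\,\mathbf{W}\subseteq[0,1]^n$, $\mathbb{E}[\mathbf{W}]=\boldsymbol{\alpha}$ and $S=\mathbf{h}^{\mathsf T}\mathbf{W}$. $S$ is comonotonically $(\mathbf{h},\boldsymbol{\alpha})$-decomposable if there is a random vector $\mathbf{X}^{\rm c}=(Q_{X_1}(U),\dots,Q_{X_n}(U))^{\mathsf T}$, where $U$ is uniformly distributed on $(0,1]$ and $Q_{X_k}$ is the quantile function of a random variable $X_k$, such that $\mathsf{supp}\,\mathbf{X}^{\rm c}\subseteq[0,1]^n$, $\mathbb{E}[\mathbf{X}^{\rm c}]=\boldsymbol{\alpha}$ and $S=\mathbf{h}^{\mathsf T}\mathbf{X}^{\rm c}=\sum_{k=1}^n h_kQ_{X_k}(U)$. The underlying probability space is taken rich enough to carry the auxiliary variables (equivalently, these are properties of the law of $S$). For nonnegative random variables $X,Y$ with finite mean, $X\le_{\mathrm{cx}}Y$ means $\mathbb{E}[f(X)]\le\mathbb{E}[f(Y)]$ for all convex $f$ for which both expectations exist (equivalently, $\pi_X(t)\le\pi_Y(t)$ for all $t\ge0$ and $\pi_X(0)=\pi_Y(0)$). $\bar S_{\mathbf{h},\boldsymbol{\alpha}}$ (maximally convex distribution) is the discrete random variable taking the values $0,\mathsf{H}_{[1]},\dots,\mathsf{H}_{[n-1]},1$ with respective probabilities $1-\alpha_1,\ \alpha_1-\alpha_2,\ \dots,\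 \alpha_{n-1}-\alpha_n,\ \alpha_n$. *)

theory Defs
  imports "HOL-Probability.Probability"
begin

text \<open>
  Vectors of length n are functions on nat, of which only the components 1, ..., n matter.
\<close>

definition partial_sum :: "(nat \<Rightarrow> real) \<Rightarrow> nat \<Rightarrow> real" where
  "partial_sum h k = (\<Sum>i=1..k. h i)"

definition tail_mean :: "nat \<Rightarrow> (nat \<Rightarrow> real) \<Rightarrow> (nat \<Rightarrow> real) \<Rightarrow> nat \<Rightarrow> real" where
  "tail_mean n h \<alpha> k = (\<Sum>i=k+1..n. h i * \<alpha> i) / (1 - partial_sum h k)"

definition stop_loss :: "'a measure \<Rightarrow> ('a \<Rightarrow> real) \<Rightarrow> real \<Rightarrow> real" where
  "stop_loss M X t = (LINT x:{t..1}|lborel. 1 - cdf (distr M borel X) x)"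

text \<open>
  For X with values in [0,1] almost surely and p in (0,1]; then the set below is nonempty.
\<close>

definition quantile :: "'a measure \<Rightarrow> ('a \<Rightarrow> real) \<Rightarrow> real \<Rightarrow> real" where
  "quantile M X p = Inf {x \<in> {0..1}. p \<le> cdf (distr M borel X) x}"

definition convex_le :: "'a measure \<Rightarrow> ('a \<Rightarrow> real) \<Rightarrow> 'b measure \<Rightarrow> ('b \<Rightarrow> real) \<Rightarrow> bool" where
  "convex_le M X N Y \<longleftrightarrow>
     (\<forall>f::real \<Rightarrow> real. convex_on UNIV f \<longrightarrow>
        integrable M (\<lambda>x. f (X x)) \<longrightarrow> integrable N (\<lambda>y. f (Y y)) \<longrightarrow>
        (LINT x|M. f (X x)) \<le> (LINT y|N. f (Y y)))"

text \<open>
  An enrichment of the probability space M by auxiliary real variables: a coupling of M with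
  some law on real sequences. A random variable S on M is read on N as S \<open>\<circ>\<close> fst.
  Real sequences suffice: if S lifts to an arbitrary extension of M that carries a random
  vector W, the joint law of the M-component and W is an enrichment of this form.
\<close>

definition enrichment :: "'a measure \<Rightarrow> ('a \<times> (nat \<Rightarrow> real)) measure \<Rightarrow> bool" where
  "enrichment M N \<longleftrightarrow> prob_space N \<and> fst \<in> measurable N M \<and> distr N M fst = M"

definition decomposes ::
  "'b measure \<Rightarrow> nat \<Rightarrow> (nat \<Rightarrow> real) \<Rightarrow> (nat \<Rightarrow> real) \<Rightarrow> ('b \<Rightarrow> real) \<Rightarrow> (nat \<Rightarrow> 'b \<Rightarrow> real) \<Rightarrow> bool"
  where
  "decomposes N n h \<alpha> S W \<longleftrightarrow>
     (\<forall>k\<in>{1..n}. W k \<in> borel_measurable N \<and> (AE \<omega> in N. W k \<omega> \<in> {0..1}) \<and>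
        (LINT \<omega>|N. W k \<omega>) = \<alpha> k) \<and>
     (AE \<omega> in N. S \<omega> = (\<Sum>k=1..n. h k * W k \<omega>))"

definition decomposable ::
  "'a measure \<Rightarrow> nat \<Rightarrow> (nat \<Rightarrow> real) \<Rightarrow> (nat \<Rightarrow> real) \<Rightarrow> ('a \<Rightarrow> real) \<Rightarrow> bool" where
  "decomposable M n h \<alpha> S \<longleftrightarrow>
     (\<exists>N W. enrichment M N \<and> decomposes N n h \<alpha> (\<lambda>\<omega>. S (fst \<omega>)) W)"

definition comonotonically_decomposable ::
  "'a measure \<Rightarrow> nat \<Rightarrow> (nat \<Rightarrow> real) \<Rightarrow> (nat \<Rightarrow> real) \<Rightarrow> ('a \<Rightarrow> real) \<Rightarrow> bool" where
  "comonotonically_decomposable M n h \<alpha> S \<longleftrightarrow>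
     (\<exists>N U X. enrichment M N \<and>
        U \<in> borel_measurable N \<and> distr N borel U = uniform_measure lborel {0<..1} \<and>
        (\<forall>k\<in>{1..n}. X k \<in> borel_measurable N \<and> (AE \<omega> in N. X k \<omega> \<in> {0..1})) \<and>
        decomposes N n h \<alpha> (\<lambda>\<omega>. S (fst \<omega>)) (\<lambda>k \<omega>. quantile N (X k) (U \<omega>)))"

text \<open>
  The maximally convex variable is the map \<open>partial_sum h\<close> on the index space {0..n},
  where k has probability \<open>\<alpha> k - \<alpha> (k + 1)\<close> with the conventions
  \<open>\<alpha> 0 = 1\<close> and \<open>\<alpha> (n + 1) = 0\<close>.
\<close>

definition max_convex_tail :: "nat \<Rightarrow> (nat \<Rightarrow> real) \<Rightarrow> nat \<Rightarrow> real" where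
  "max_convex_tail n \<alpha> k = (if k = 0 then 1 else if k \<le> n then \<alpha> k else 0)"

definition max_convex_prob :: "nat \<Rightarrow> (nat \<Rightarrow> real) \<Rightarrow> nat \<Rightarrow> real" where
  "max_convex_prob n \<alpha> k = max_convex_tail n \<alpha> k - max_convex_tail n \<alpha> (Suc k)"

definition max_convex_space :: "nat \<Rightarrow> (nat \<Rightarrow> real) \<Rightarrow> nat measure" where
  "max_convex_space n \<alpha> = point_measure {0..n} (\<lambda>k. ennreal (max_convex_prob n \<alpha> k))"

definition max_convex_var :: "(nat \<Rightarrow> real) \<Rightarrow> nat \<Rightarrow> real" where
  "max_convex_var h k = partial_sum h k"

lemma max_convex_prob_nonneg:
  assumes "\<alpha> 1 \<le> 1" "strict_antimono_on {1..n} \<alpha>" "\<alpha> n > 0" "k \<le> n"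
  shows "max_convex_prob n \<alpha> k \<ge> 0"
proof -
  have "k \<noteq> 0 \<Longrightarrow> Suc k \<le> n \<Longrightarrow> \<alpha> (Suc k) < \<alpha> k"
    using assms(2) by (auto simp: monotone_on_def)
  with assms show ?thesis
    by (cases "k = n") (auto simp: max_convex_prob_def max_convex_tail_def)
qed

lemma prob_space_max_convex_space:
  assumes "\<alpha> 1 \<le> 1" "strict_antimono_on {1..n} \<alpha>" "\<alpha> n > 0"
  shows "prob_space (max_convex_space n \<alpha>)"
proof
  have "(\<Sum>k\<in>{0..n}. ennreal (max_convex_prob n \<alpha> k)) =
        ennreal (\<Sum>k<Suc n. max_convex_prob n \<alpha> k)"
    using max_convex_prob_nonneg[OF assms]
    by (subst sum_ennreal) (auto simp only: atLeast0AtMost lessThan_Suc_atMost atMost_iff)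
  also have "(\<Sum>k<Suc n. max_convex_prob n \<alpha> k) = 1"
    unfolding max_convex_prob_def sum_lessThan_telescope'
    by (simp add: max_convex_tail_def)
  finally show "emeasure (max_convex_space n \<alpha>) (space (max_convex_space n \<alpha>)) = 1"
    by (simp add: max_convex_space_def space_point_measure emeasure_point_measure_finite)
qed

lemma measure_max_convex_var:
  assumes "\<alpha> 1 \<le> 1" "strict_antimono_on {1..n} \<alpha>" "\<alpha> n > 0"
    and "\<forall>k\<in>{1..n}. h k > 0" "k \<le> n"
  shows "measure (max_convex_space n \<alpha>)
           {j \<in> space (max_convex_space n \<alpha>). max_convex_var h j = partial_sum h k} =
         max_convex_prob n \<alpha> k"
proof -
  have mono: "partial_sum h i < partial_sum h j" if "i < j" "j \<le> n" for i j
    unfolding partial_sum_def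
  proof (rule sum_strict_mono2)
    show "j \<in> {1..j} - {1..i}" "0 < h j" and "\<And>x. x \<in> {1..j} \<Longrightarrow> 0 \<le> h x"
      using that assms(4) by (auto intro: less_imp_le)
  qed (use that in auto)
  have "j = k" if "j \<le> n" "partial_sum h j = partial_sum h k" for j
    using mono[of j k] mono[of k j] that assms(5) by linarith
  then have "{j \<in> {0..n}. max_convex_var h j = partial_sum h k} = {k}"
    using assms(5) unfolding max_convex_var_def by auto
  moreover have "emeasure (max_convex_space n \<alpha>) {k} = ennreal (max_convex_prob n \<alpha> k)"
    using assms(5) by (simp add: max_convex_space_def emeasure_point_measure_finite)
  ultimately show ?thesis
    using max_convex_prob_nonneg[OF assms(1-3,5)]
    by (simp add: measure_def max_convex_space_def space_point_measure)
qed

end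

theory Submission
  imports Defs
begin

text \<open>
  A comonotone decomposition of S is the same as a family of nondecreasing functions
  \<open>w k\<close> with values in [0,1] and \<open>(\<Sum>k. h k * w k s) = s\<close>, evaluated at S: the components are
  filled up as s runs from 0 to 1. Filling them one after the other gives
  \<open>(\<Sum>i\<le>k. h i * w i s) = min s (partial_sum h k)\<close>, so the stop-loss condition says exactly that the
  means of this greedy filling dominate \<open>\<alpha>\<close> in the weighted majorization order. As in the theorem of
  Hardy, Littlewood and Polya, finitely many transfers (mixing two components) then move the
  means to \<open>\<alpha>\<close>. The same domination, summed by parts against the slopes of a convex function on the
  grid of partial sums, gives the convex order.
\<close>

subsection \<open>Fillings and transfers\<close>

text \<open>The greedy filling is extremal: in every decomposition the first k components contribute
  at most S and at most \<open>partial_sum h k\<close>, and the greedy filling attains the minimum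
  of the two for all k at once. So the stop-loss condition is necessary, and the transfers only have
  to lower prefix means that are too large. A second obstacle is that S is given: a comonotone
  decomposition needs a uniform U whose quantiles reproduce \<open>w k (S \<omega>)\<close> almost
  surely, not just in law. The distribution function of S, evaluated at S, is not uniform when S has
  atoms. An independent uniform V, carried by an enrichment of M, spreads each atom over its jump.
  The resulting U is built from S and V alone, so one U serves every \<open>w k\<close>. For the
  convex order the grid is enough because the maximally convex variable lives on it: a convex f and
  its piecewise linear interpolant have the same mean there, while f lies below the interpolant on
  [0,1].\<close>

lemma partial_sum_0 [simp]: "partial_sum h 0 = 0"
  by (simp add: partial_sum_def)

lemma partial_sum_Suc [simp]: "partial_sum h (Suc k) = partial_sum h k + h (Suc k)"
  by (simp add: partial_sum_def)

lemma partial_sum_mono: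
  assumes "\<forall>i\<in>{1..n}. 0 \<le> h i" "j \<le> k" "k \<le> n"
  shows "partial_sum h j \<le> partial_sum h k"
  unfolding partial_sum_def using assms by (intro sum_mono2) auto

lemma partial_sum_split:
  assumes "k \<le> n"
  shows "partial_sum h n = partial_sum h k + (\<Sum>i=k+1..n. h i)"
  unfolding partial_sum_def using assms
  by (subst sum.union_disjoint[symmetric]) (auto intro!: sum.cong)

text \<open>Monotonicity and range are required on the whole line, so that \<open>w k\<close> is
  Borel and \<open>w k (S \<omega>)\<close> is in [0,1] even on the null set where S leaves [0,1].
  The identity for the sum is asked only on [0,1], since a weighted mean of values in [0,1] cannot
  equal any other s.\<close>

definition filling :: "nat \<Rightarrow> (nat \<Rightarrow> real) \<Rightarrow> (nat \<Rightarrow> real \<Rightarrow> real) \<Rightarrow> bool" where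
  "filling n h w \<longleftrightarrow> (\<forall>k\<in>{1..n}. mono (w k) \<and> (\<forall>s. w k s \<in> {0..1})) \<and>
     (\<forall>s\<in>{0..1}. (\<Sum>k=1..n. h k * w k s) = s)"

lemma filling_measurable: "filling n h w \<Longrightarrow> k \<in> {1..n} \<Longrightarrow> w k \<in> borel_measurable borel"
  unfolding filling_def by (blast intro: borel_measurable_mono)

text \<open>For k at least 1 and positive \<open>h k\<close> this is (s - H_(k-1)) / h_k clamped to
  [0,1]: component k fills up while s crosses the k-th grid interval. The difference of minima makes
  weighted sums telescope.\<close>

definition greedy :: "(nat \<Rightarrow> real) \<Rightarrow> nat \<Rightarrow> real \<Rightarrow> real" where
  "greedy h k s = (min s (partial_sum h k) - min s (partial_sum h (k - 1))) / h k"

lemma sum_greedy: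
  assumes "\<forall>i\<in>{1..k}. 0 < h i" "0 \<le> s"
  shows "(\<Sum>i=1..k. h i * greedy h i s) = min s (partial_sum h k)"
  using assms
proof (induction k)
  case (Suc k)
  have "h (Suc k) > 0" using Suc.prems by auto
  with Suc show ?case by (simp add: greedy_def)
qed simp

lemma mono_greedy:
  assumes "0 < h (Suc k)"
  shows "mono (greedy h (Suc k))"
  using assms by (intro monoI) (auto simp: greedy_def min_def intro!: divide_right_mono)

lemma greedy_range:
  assumes "0 < h (Suc k)"
  shows "greedy h (Suc k) s \<in> {0..1}"
  using assms by (auto simp: greedy_def min_def divide_simps)

lemma filling_greedy:
  assumes "\<forall>k\<in>{1..n}. 0 < h k" "partial_sum h n = 1"
  shows "filling n h (greedy h)"
proof -
  have "mono (greedy h k) \<and> (\<forall>s. greedy h k s \<in> {0..1})" if "k \<in> {1..n}" for k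
    using that assms(1) mono_greedy[of h "k-1"] greedy_range[of h "k-1"] by auto
  moreover have "(\<Sum>k=1..n. h k * greedy h k s) = s" if "s \<in> {0..1}" for s
    using sum_greedy[OF assms(1), of s] that assms(2) by simp
  ultimately show ?thesis unfolding filling_def by blast
qed

lemma (in prob_space) integrable_filling:
  assumes "filling n h w" "S \<in> borel_measurable M" "k \<in> {1..n}"
  shows "integrable M (\<lambda>\<omega>. w k (S \<omega>))"
proof (rule integrable_const_bound[where B = 1])
  show "AE \<omega> in M. norm (w k (S \<omega>)) \<le> 1"
    using assms(1,3) by (auto simp: filling_def)
  show "(\<lambda>\<omega>. w k (S \<omega>)) \<in> borel_measurable M"
    using filling_measurable[OF assms(1,3)] assms(2) by measurable
qed

text \<open>Each of the two new components is a convex combination of \<open>w i\<close> and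
  \<open>w j\<close>, with weights c / h i and c / h j in [0,1], so it stays nondecreasing and in
  [0,1]. The weighted amount c * (w i s - w j s) taken from i is given to j, which preserves the
  sum.\<close>

lemma filling_transfer:
  assumes w: "filling n h w" and h: "\<forall>k\<in>{1..n}. 0 < h k"
    and ij: "i \<in> {1..n}" "j \<in> {1..n}" "i \<noteq> j"
    and c: "0 \<le> c" "c \<le> h i" "c \<le> h j"
  shows "filling n h (w(i := (\<lambda>s. w i s - c / h i * (w i s - w j s)),
                        j := (\<lambda>s. w j s + c / h j * (w i s - w j s))))" (is "filling n h ?v")
proof -
  have conv: "mono (\<lambda>s. (1 - t) * f s + t * g s) \<and> (\<forall>s. (1 - t) * f s + t * g s \<in> {0..1})"
    if "0 \<le> t" "t \<le> 1" "mono f" "mono g" "\<forall>s. f s \<in> {0..1}" "\<forall>s. g s \<in> {0..1}"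
    for t and f g :: "real \<Rightarrow> real"
  proof (intro conjI allI monoI)
    fix x y :: real assume "x \<le> y"
    then show "(1 - t) * f x + t * g x \<le> (1 - t) * f y + t * g y"
      using that by (intro add_mono mult_left_mono) (auto dest: monoD)
  next
    fix s
    have "(1 - t) * f s + t * g s \<le> (1 - t) * 1 + t * 1"
      using that by (intro add_mono mult_left_mono) auto
    then show "(1 - t) * f s + t * g s \<in> {0..1}" using that by auto
  qed
  have hp: "0 < h i" "0 < h j" using h ij by auto
  have "mono (?v k) \<and> (\<forall>s. ?v k s \<in> {0..1})" if k: "k \<in> {1..n}" for k
  proof -
    have *: "mono (w k) \<and> (\<forall>s. w k s \<in> {0..1})" if "k \<in> {1..n}" for k
      using w that by (auto simp: filling_def)
    consider "k = i" | "k = j" | "k \<noteq> i" "k \<noteq> j" by blast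
    then show ?thesis
    proof cases
      case 1
      then have "?v k = (\<lambda>s. (1 - c / h i) * w i s + c / h i * w j s)"
        using ij by (auto simp: fun_eq_iff algebra_simps)
      then show ?thesis
        using conv[of "c / h i" "w i" "w j"] *[OF ij(1)] *[OF ij(2)] c hp by simp
    next
      case 2
      then have "?v k = (\<lambda>s. (1 - c / h j) * w j s + c / h j * w i s)"
        by (auto simp: fun_eq_iff algebra_simps)
      then show ?thesis
        using conv[of "c / h j" "w j" "w i"] *[OF ij(1)] *[OF ij(2)] c hp by simp
    next
      case 3
      then show ?thesis using *[OF k] by simp
    qed
  qed
  moreover have "(\<Sum>k=1..n. h k * ?v k s) = s" if s: "s \<in> {0..1}" for s
  proof -
    let ?d = "c * (w i s - w j s)"
    have "(\<Sum>k=1..n. h k * ?v k s) =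
        (\<Sum>k=1..n. h k * w k s - (if k = i then ?d else 0) + (if k = j then ?d else 0))"
      using hp ij by (intro sum.cong) (auto simp: field_simps)
    also have "\<dots> = (\<Sum>k=1..n. h k * w k s)"
      using ij by (simp add: sum.distrib sum_subtractf)
    finally show ?thesis using w s by (simp add: filling_def)
  qed
  ultimately show ?thesis unfolding filling_def by blast
qed

text \<open>Weighted Hardy-Littlewood-Polya argument, by induction on the number of components with
  a wrong mean. Each transfer corrects at least one mean, spoils none that was right, and keeps the
  domination of prefix sums.\<close>

lemma (in prob_space) ex_filling_expectation:
  assumes S: "S \<in> borel_measurable M"
    and h: "\<forall>k\<in>{1..n}. 0 < h k" and \<alpha>: "antimono_on {1..n} \<alpha>"
    and w: "filling n h w"
    and le: "\<forall>k\<le>n. (\<Sum>i=1..k. h i * \<alpha> i) \<le> (\<Sum>i=1..k. h i * expectation (\<lambda>\<omega>. w i (S \<omega>)))"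
    and eq: "(\<Sum>i=1..n. h i * \<alpha> i) = (\<Sum>i=1..n. h i * expectation (\<lambda>\<omega>. w i (S \<omega>)))"
  shows "\<exists>v. filling n h v \<and> (\<forall>k\<in>{1..n}. expectation (\<lambda>\<omega>. v k (S \<omega>)) = \<alpha> k)"
  using w le eq
proof (induction "card {k\<in>{1..n}. expectation (\<lambda>\<omega>. w k (S \<omega>)) \<noteq> \<alpha> k}"
    arbitrary: w rule: less_induct)
  case less
  note w = less.prems(1) and le = less.prems(2) and eq = less.prems(3)
  define \<beta> where "\<beta> k = expectation (\<lambda>\<omega>. w k (S \<omega>))" for k
  have le': "(\<Sum>i=1..k. h i * \<alpha> i) \<le> (\<Sum>i=1..k. h i * \<beta> i)" if "k \<le> n" for k
    using le that by (simp add: \<beta>_def)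
  show ?case
  proof (cases "\<forall>k\<in>{1..n}. \<beta> k = \<alpha> k")
    case True
    with w show ?thesis by (auto simp: \<beta>_def)
  next
    case False
    \<comment> \<open>With equal totals, means that are all at least their targets would all be
      exact.\<close>
    have "\<exists>k\<in>{1..n}. \<beta> k < \<alpha> k"
    proof (rule ccontr)
      assume "\<not> ?thesis"
      then have nn: "\<forall>k\<in>{1..n}. 0 \<le> h k * (\<beta> k - \<alpha> k)" using h by (auto simp: not_less)
      have "(\<Sum>k=1..n. h k * (\<beta> k - \<alpha> k)) = 0"
        using eq by (simp add: \<beta>_def algebra_simps sum_subtractf)
      then have "\<forall>k\<in>{1..n}. h k * (\<beta> k - \<alpha> k) = 0"
        using nn by (subst (asm) sum_nonneg_eq_0_iff) auto
      with False h show False by fastforce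
    qed
    \<comment> \<open>The least index matters twice: domination at j then forces a strict surplus at
      some earlier i, and between i and j no component has a deficit.\<close>
    define j where "j = (LEAST k. k \<in> {1..n} \<and> \<beta> k < \<alpha> k)"
    have j: "j \<in> {1..n}" "\<beta> j < \<alpha> j"
      using LeastI_ex[of "\<lambda>k. k \<in> {1..n} \<and> \<beta> k < \<alpha> k"] \<open>\<exists>k\<in>_. _\<close> unfolding j_def by blast+
    have below_j: "\<alpha> k \<le> \<beta> k" if "k \<in> {1..n}" "k < j" for k
      using not_less_Least[of k "\<lambda>k. k \<in> {1..n} \<and> \<beta> k < \<alpha> k"] that unfolding j_def by auto
    have "\<exists>i\<in>{1..n}. i < j \<and> \<alpha> i < \<beta> i"
    proof (rule ccontr)
      assume "\<not> ?thesis"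
      then have "\<beta> k = \<alpha> k" if "k \<in> {1..n}" "k < j" for k
        using below_j[OF that] that by force
      then have "(\<Sum>k=1..j. h k * (\<beta> k - \<alpha> k)) = (\<Sum>k\<in>{j}. h k * (\<beta> k - \<alpha> k))"
        using j by (intro sum.mono_neutral_right) auto
      also have "\<dots> < 0" using h j by (auto simp: mult_pos_neg)
      finally show False using le'[of j] j by (simp add: algebra_simps sum_subtractf)
    qed
    then obtain i where i: "i \<in> {1..n}" "i < j" "\<alpha> i < \<beta> i" by blast
    \<comment> \<open>The transferred mass is the largest that keeps component i above and component j below
      its target; one of the two targets is hit, so the number of wrong means drops.\<close>
    define \<delta> where "\<delta> = min (h i * (\<beta> i - \<alpha> i)) (h j * (\<alpha> j - \<beta> j))"
    \<comment> \<open>A transfer with constant c moves the expected weighted mass c * (\<beta> i -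
      \<beta> j), so this c moves exactly \<delta>.\<close>
    define c where "c = \<delta> / (\<beta> i - \<beta> j)"
    have hp: "0 < h i" "0 < h j" using h i j by auto
    \<comment> \<open>Here the order of \<alpha> enters: \<beta> j < \<alpha> j \<le> \<alpha> i <
      \<beta> i. Hence mass flows from i to j, and both gaps to the targets are at most \<beta> i -
      \<beta> j, which bounds c by \<open>h i\<close> and \<open>h j\<close>.\<close>
    have "\<alpha> j \<le> \<alpha> i" using \<alpha> i j by (auto simp: monotone_on_def)
    then have diff: "\<beta> i - \<alpha> i \<le> \<beta> i - \<beta> j" "\<alpha> j - \<beta> j \<le> \<beta> i - \<beta> j" "0 < \<beta> i - \<beta> j"
      using i j by auto
    have \<delta>: "0 < \<delta>" using hp i j by (simp add: \<delta>_def)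
    have "\<delta> \<le> h i * (\<beta> i - \<beta> j)" "\<delta> \<le> h j * (\<beta> i - \<beta> j)"
      using mult_left_mono[OF diff(1), of "h i"] mult_left_mono[OF diff(2), of "h j"] hp
      unfolding \<delta>_def by linarith+
    then have c: "0 \<le> c" "c \<le> h i" "c \<le> h j" "c * (\<beta> i - \<beta> j) = \<delta>"
      using diff \<delta> by (auto simp: c_def divide_simps)
    define v where "v = w(i := (\<lambda>s. w i s - c / h i * (w i s - w j s)),
                          j := (\<lambda>s. w j s + c / h j * (w i s - w j s)))"
    have v: "filling n h v"
      unfolding v_def using filling_transfer[OF w h i(1) j(1) _ c(1-3)] i by auto
    have int: "integrable M (\<lambda>\<omega>. w i (S \<omega>))" "integrable M (\<lambda>\<omega>. w j (S \<omega>))"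
      using integrable_filling[OF w S] i j by auto
    define \<gamma> where "\<gamma> k = expectation (\<lambda>\<omega>. v k (S \<omega>))" for k
    have "\<gamma> i = \<beta> i - c / h i * (\<beta> i - \<beta> j)"
      using i int by (simp add: \<gamma>_def v_def \<beta>_def)
    then have \<gamma>i: "h i * \<gamma> i = h i * \<beta> i - \<delta>" using hp c(4) by (simp add: field_simps)
    have "\<gamma> j = \<beta> j + c / h j * (\<beta> i - \<beta> j)"
      using int by (simp add: \<gamma>_def v_def \<beta>_def)
    then have \<gamma>j: "h j * \<gamma> j = h j * \<beta> j + \<delta>" using hp c(4) by (simp add: field_simps)
    have \<gamma>: "\<gamma> k = \<beta> k" if "k \<noteq> i" "k \<noteq> j" for k
      using that by (simp add: \<gamma>_def v_def \<beta>_def)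
    have sum: "(\<Sum>l=1..k. h l * \<gamma> l) =
        (\<Sum>l=1..k. h l * \<beta> l) - (if i \<le> k then \<delta> else 0) + (if j \<le> k then \<delta> else 0)" for k
    proof -
      have "(\<Sum>l=1..k. h l * \<gamma> l) =
          (\<Sum>l=1..k. h l * \<beta> l - (if l = i then \<delta> else 0) + (if l = j then \<delta> else 0))"
        using \<gamma>i \<gamma>j \<gamma> i by (intro sum.cong) auto
      then show ?thesis using i j by (simp add: sum.distrib sum_subtractf)
    qed
    have "(\<Sum>l=1..k. h l * \<alpha> l) \<le> (\<Sum>l=1..k. h l * \<gamma> l)" if k: "k \<le> n" for k
    \<comment> \<open>Only prefixes that contain i but not j lose \<delta>. The surplus of component
      i alone covers the loss, and the other terms from i to k are nonnegative because k <
      j.\<close>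
    proof (cases "i \<le> k \<and> k < j")
      case True
      have split: "(\<Sum>l=1..k. f l) = (\<Sum>l=1..i-1. f l) + (\<Sum>l=i..k. f l)" for f :: "nat \<Rightarrow> real"
        using True i by (subst sum.union_disjoint[symmetric]) (auto intro!: sum.cong)
      have "\<delta> \<le> h i * (\<beta> i - \<alpha> i)" by (simp add: \<delta>_def)
      also have "\<dots> \<le> (\<Sum>l=i..k. h l * (\<beta> l - \<alpha> l))"
        using True i j h below_j by (intro member_le_sum) (auto intro!: mult_nonneg_nonneg simp: less_imp_le)
      finally have "\<delta> \<le> (\<Sum>l=i..k. h l * \<beta> l) - (\<Sum>l=i..k. h l * \<alpha> l)"
        by (simp add: algebra_simps sum_subtractf)
      moreover have "i - 1 \<le> n" using i by auto
      ultimately show ?thesis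
        using le'[of "i-1"] True sum[of k] split[of "\<lambda>l. h l * \<alpha> l"] split[of "\<lambda>l. h l * \<beta> l"]
        by (simp split: if_splits)
    next
      case False
      then show ?thesis using sum[of k] le'[OF k] i by (auto split: if_splits)
    qed
    moreover have "(\<Sum>i=1..n. h i * \<alpha> i) = (\<Sum>i=1..n. h i * \<gamma> i)"
      using sum[of n] eq i j by (simp add: \<beta>_def)
    moreover have "card {k\<in>{1..n}. \<gamma> k \<noteq> \<alpha> k} < card {k\<in>{1..n}. \<beta> k \<noteq> \<alpha> k}"
    proof (rule psubset_card_mono)
      have *: "\<gamma> i = \<alpha> i \<or> \<gamma> j = \<alpha> j"
      proof (cases "h i * (\<beta> i - \<alpha> i) \<le> h j * (\<alpha> j - \<beta> j)")
        case True
        then have "h i * \<gamma> i = h i * \<alpha> i" using \<gamma>i by (simp add: \<delta>_def algebra_simps)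
        then show ?thesis using hp by simp
      next
        case False
        then have "h j * \<gamma> j = h j * \<alpha> j" using \<gamma>j by (simp add: \<delta>_def algebra_simps)
        then show ?thesis using hp by simp
      qed
      \<comment> \<open>Both i and j had wrong means before the transfer, so no new wrong index can
        appear.\<close>
      moreover have "\<beta> k \<noteq> \<alpha> k" if "\<gamma> k \<noteq> \<alpha> k" for k
        using \<gamma>[of k] i(3) j(2) that by (cases "k = i"; cases "k = j") auto
      ultimately show "{k\<in>{1..n}. \<gamma> k \<noteq> \<alpha> k} \<subset> {k\<in>{1..n}. \<beta> k \<noteq> \<alpha> k}"
      proof (intro psubsetI subsetI, goal_cases)
        case (1 k)
        then show ?case by simp
      next
        case 2
        obtain m where "m \<in> {1..n}" "\<gamma> m = \<alpha> m" "\<beta> m \<noteq> \<alpha> m"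
          using * i(1,3) j by force
        then have "m \<in> {k\<in>{1..n}. \<beta> k \<noteq> \<alpha> k}" "m \<notin> {k\<in>{1..n}. \<gamma> k \<noteq> \<alpha> k}" by simp_all
        then show ?case by metis
      qed
    qed simp
    ultimately show ?thesis
      using v by (intro less.hyps[of v, folded \<gamma>_def \<beta>_def]) simp_all
  qed
qed

section \<open>Interpolation of convex functions on the grid, and summation by parts\<close>

text \<open>The right-hand side is the piecewise linear interpolant of f at the grid points:
  intervals below s contribute their full increment, the one containing s its fraction, later ones
  nothing. A convex function lies below its chords.\<close>

lemma convex_on_le_greedy:
  fixes f :: "real \<Rightarrow> real"
  assumes f: "convex_on UNIV f" and h: "\<forall>i\<in>{1..k}. 0 < h i"
    and s: "0 \<le> s" "s \<le> partial_sum h k"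
  shows "f s \<le> f 0 + (\<Sum>i=1..k. greedy h i s * (f (partial_sum h i) - f (partial_sum h (i - 1))))"
  using h s
proof (induction k)
  case (Suc k)
  have hp: "0 < h (Suc k)" using Suc.prems by auto
  show ?case
  proof (cases "s \<le> partial_sum h k")
    case True
    then have "greedy h (Suc k) s = 0" using hp by (simp add: greedy_def)
    then show ?thesis using Suc True by simp
  next
    case False
    have "greedy h i s = 1" if "i \<in> {1..k}" for i
    proof -
      have "partial_sum h i \<le> partial_sum h k" "partial_sum h (i - 1) \<le> partial_sum h k"
        using that Suc.prems(1) by (auto intro!: partial_sum_mono[of k] simp: less_imp_le)
      moreover have "partial_sum h i = partial_sum h (i - 1) + h i"
        using that partial_sum_Suc[of h "i - 1"] by simp
      moreover have "h i > 0" using that Suc.prems(1) by auto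
      ultimately show ?thesis using False by (simp add: greedy_def)
    qed
    then have "(\<Sum>i=1..k. greedy h i s * (f (partial_sum h i) - f (partial_sum h (i - 1))))
        = (\<Sum>i=1..k. f (partial_sum h i) - f (partial_sum h (i - 1)))" by simp
    also have "\<dots> = f (partial_sum h k) - f 0"
      by (induction k) auto
    finally have *: "(\<Sum>i=1..k. greedy h i s * (f (partial_sum h i) - f (partial_sum h (i - 1))))
        = f (partial_sum h k) - f 0" .
    define t where "t = greedy h (Suc k) s"
    have t: "t \<in> {0..1}" unfolding t_def by (rule greedy_range[of h k s, OF hp])
    have "s = (1 - t) * partial_sum h k + t * partial_sum h (Suc k)"
      using False Suc.prems hp by (simp add: t_def greedy_def field_simps)
    then have "f s \<le> (1 - t) * f (partial_sum h k) + t * f (partial_sum h (Suc k))"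
      using convex_onD[OF f, of t "partial_sum h k" "partial_sum h (Suc k)"] t by simp
    then show ?thesis using * by (simp add: t_def algebra_simps)
  qed
qed simp

text \<open>Summation by parts: larger prefix sums with the same total put more weight on early
  indices, where d is small. In the use below, \<open>d i\<close> is the slope of a convex function
  on the i-th grid interval.\<close>

lemma abel_sum_le:
  fixes \<alpha> \<beta> h d :: "nat \<Rightarrow> real"
  assumes d: "\<And>k. 1 \<le> k \<Longrightarrow> k < n \<Longrightarrow> d k \<le> d (Suc k)"
    and le: "\<forall>k\<le>n. (\<Sum>i=1..k. h i * \<alpha> i) \<le> (\<Sum>i=1..k. h i * \<beta> i)"
    and eq: "(\<Sum>i=1..n. h i * \<alpha> i) = (\<Sum>i=1..n. h i * \<beta> i)"
  shows "(\<Sum>i=1..n. \<beta> i * (h i * d i)) \<le> (\<Sum>i=1..n. \<alpha> i * (h i * d i))"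
proof -
  \<comment> \<open>The induction keeps the boundary term: the prefix surplus is nonnegative, so
    \<open>d k\<close> may be raised to \<open>d (Suc k)\<close>. At n the surplus is zero and the
    boundary term disappears.\<close>
  have "(\<Sum>i=1..k. \<beta> i * (h i * d i)) - (\<Sum>i=1..k. \<alpha> i * (h i * d i))
      \<le> ((\<Sum>i=1..k. h i * \<beta> i) - (\<Sum>i=1..k. h i * \<alpha> i)) * d k" if "k \<le> n" for k
    using that
  proof (induction k)
    case (Suc k)
    show ?case
    proof (cases k)
      case 0 then show ?thesis by (simp add: algebra_simps)
    next
      case (Suc l)
      have "((\<Sum>i=1..k. h i * \<beta> i) - (\<Sum>i=1..k. h i * \<alpha> i)) * d k
         \<le> ((\<Sum>i=1..k. h i * \<beta> i) - (\<Sum>i=1..k. h i * \<alpha> i)) * d (Suc k)"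
        using d[of k] le[rule_format, of k] Suc.prems Suc by (intro mult_left_mono) simp_all
      then show ?thesis using Suc.IH Suc.prems by (simp add: algebra_simps)
    qed
  qed simp
  from this[of n] eq show ?thesis by simp
qed

text \<open>Tail-sum formula: \<open>\<alpha> i\<close> is the probability that the index is at
  least i, and this event picks up the i-th increment of f along the grid.\<close>

lemma expectation_max_convex:
  assumes "\<alpha> 1 \<le> 1" "strict_antimono_on {1..n} \<alpha>" "\<alpha> n > 0" "n \<ge> 1"
  shows "(LINT k|max_convex_space n \<alpha>. f (max_convex_var h k)) =
    f 0 + (\<Sum>i=1..n. \<alpha> i * (f (partial_sum h i) - f (partial_sum h (i - 1))))"
proof -
  have "(LINT k|max_convex_space n \<alpha>. f (max_convex_var h k)) =
      (\<Sum>k\<in>{0..n}. max_convex_prob n \<alpha> k * f (partial_sum h k))"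
    unfolding max_convex_space_def max_convex_var_def
    using max_convex_prob_nonneg[OF assms(1-3)]
    by (subst lebesgue_integral_point_measure_finite) auto
  also have "\<dots> = (\<Sum>k\<le>n. max_convex_prob n \<alpha> k * f (partial_sum h k))"
    by (simp add: atLeast0AtMost)
  also have "\<dots> = f 0 + (\<Sum>i=1..n. \<alpha> i * (f (partial_sum h i) - f (partial_sum h (i - 1))))"
  proof -
    \<comment> \<open>Stopping at m leaves a boundary term, which vanishes at m = n because the tail
      beyond n is 0 by convention.\<close>
    have "(\<Sum>k\<le>m. max_convex_prob n \<alpha> k * f (partial_sum h k)) =
      f 0 + (\<Sum>i=1..m. \<alpha> i * (f (partial_sum h i) - f (partial_sum h (i - 1))))
        - max_convex_tail n \<alpha> (Suc m) * f (partial_sum h m)" if "m \<le> n" for m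
      using that
      by (induction m) (auto simp: max_convex_prob_def max_convex_tail_def algebra_simps)
    from this[of n] show ?thesis by (simp add: max_convex_tail_def)
  qed
  finally show ?thesis .
qed

subsection \<open>Quantiles and the distributional transform\<close>

lemma (in prob_space) cdf_distr_eq_prob:
  assumes "X \<in> borel_measurable M"
  shows "cdf (distr M borel X) x = prob {\<omega>\<in>space M. X \<omega> \<le> x}"
  using assms by (simp add: cdf_def measure_distr vimage_def Int_def conj_commute)

text \<open>Fubini for the indicator of t \<le> x < X: integrating over \<omega> first gives the
  tail probability, integrating over x first gives the length of [t, X). The bound X \<le> 1 is what
  lets the integral end at 1.\<close>

lemma (in prob_space) stop_loss_eq_expectation:
  assumes X [measurable]: "X \<in> borel_measurable M" and le: "AE \<omega> in M. X \<omega> \<le> 1"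
  shows "stop_loss M X t = expectation (\<lambda>\<omega>. max (X \<omega> - t) 0)"
proof -
  interpret P: pair_sigma_finite M lborel ..
  let ?f = "\<lambda>\<omega> x. indicator {t..1} x * indicator {..<X \<omega>} x :: real"
  have [measurable]: "(\<lambda>(\<omega>, x). ?f \<omega> x) \<in> borel_measurable (M \<Otimes>\<^sub>M lborel)"
    unfolding indicator_def by simp
  have int: "integrable (M \<Otimes>\<^sub>M lborel) (\<lambda>(\<omega>, x). ?f \<omega> x)"
  proof (rule Bochner_Integration.integrable_bound)
    show "integrable (M \<Otimes>\<^sub>M lborel) (indicator (space M \<times> {t..1}) :: _ \<Rightarrow> real)"
      by (subst integrable_indicator_iff)
         (auto simp: lborel.emeasure_pair_measure_Times emeasure_space_1 emeasure_lborel_Icc_eq)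
  qed (auto simp: indicator_def space_pair_measure)
  have "stop_loss M X t = (LINT x|lborel. (LINT \<omega>|M. ?f \<omega> x))"
    unfolding stop_loss_def set_lebesgue_integral_def
  proof (rule Bochner_Integration.integral_cong[OF refl])
    fix x
    have "1 - cdf (distr M borel X) x = 1 - prob {\<omega>\<in>space M. X \<omega> \<le> x}"
      by (simp only: cdf_distr_eq_prob[OF X])
    also have "\<dots> = prob {\<omega>\<in>space M. x < X \<omega>}"
      by (subst prob_neg[symmetric]) (auto simp: not_le)
    also have "\<dots> = (LINT \<omega>|M. indicator {..<X \<omega>} x)"
    proof -
      have "(LINT \<omega>|M. indicator {..<X \<omega>} x :: real)
          = (LINT \<omega>|M. indicator {\<omega>\<in>space M. x < X \<omega>} \<omega>)"
        by (rule Bochner_Integration.integral_cong) (auto simp: indicator_def)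
      then show ?thesis by simp
    qed
    finally show "indicator {t..1} x *\<^sub>R (1 - cdf (distr M borel X) x) = (LINT \<omega>|M. ?f \<omega> x)"
      by simp
  qed
  also have "\<dots> = (LINT \<omega>|M. (LINT x|lborel. ?f \<omega> x))"
    using P.Fubini_integral[OF int] .
  also have "\<dots> = expectation (\<lambda>\<omega>. max (X \<omega> - t) 0)"
  proof (rule integral_cong_AE)
    show "AE \<omega> in M. (LINT x|lborel. ?f \<omega> x) = max (X \<omega> - t) 0"
      using le
    proof eventually_elim
      case (elim \<omega>)
      then have "?f \<omega> = indicator {t..<X \<omega>}" by (auto simp: indicator_def fun_eq_iff)
      then show ?case by (cases "t \<le> X \<omega>") auto
    qed
  qed (use P.integrable_fst[OF int] in auto)
  finally show ?thesis .
qed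

lemma cdf_uniform_01:
  "cdf (uniform_measure lborel {0<..1}) x = max 0 (min x 1)"
proof -
  have *: "{0<..1} \<inter> {..x} = {0<..min x (1::real)}" by auto
  have "cdf (uniform_measure lborel {0<..1}) x = measure lborel {0<..min x 1}"
    by (simp add: cdf_def *)
  then show ?thesis by (cases "0 \<le> min x 1") auto
qed

lemma real_distribution_uniform_01: "real_distribution (uniform_measure lborel {0<..1::real})"
  by (auto simp: real_distribution_def real_distribution_axioms_def intro!: prob_space_uniform_measure)

text \<open>The two one-sided bounds, one for the closed and one for the open half-line, are the
  form in which a sandwich of events delivers uniformity.\<close>

lemma (in prob_space) distr_eq_uniform_01:
  assumes U [measurable]: "U \<in> borel_measurable M" and range: "AE \<omega> in M. U \<omega> \<in> {0..1}"
    and ge: "\<And>u. 0 < u \<Longrightarrow> u < 1 \<Longrightarrow> u \<le> prob {\<omega>\<in>space M. U \<omega> \<le> u}"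
    and le: "\<And>u. 0 < u \<Longrightarrow> u < 1 \<Longrightarrow> prob {\<omega>\<in>space M. U \<omega> < u} \<le> u"
  shows "distr M borel U = uniform_measure lborel {0<..1}"
proof (rule cdf_unique[OF _ real_distribution_uniform_01])
  show "real_distribution (distr M borel U)" by simp
  show "cdf (distr M borel U) = cdf (uniform_measure lborel {0<..1})"
  proof
    fix x
    have eq: "cdf (distr M borel U) x = prob {\<omega>\<in>space M. U \<omega> \<le> x}"
      by (rule cdf_distr_eq_prob[OF U])
    consider "x < 0" | "0 \<le> x" "x < 1" | "1 \<le> x" by linarith
    then have "prob {\<omega>\<in>space M. U \<omega> \<le> x} = max 0 (min x 1)"
    proof cases
      case 1
      have "AE \<omega> in M. \<not> U \<omega> \<le> x" using range by eventually_elim (use 1 in auto)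
      then have "prob {\<omega>\<in>space M. U \<omega> \<le> x} = 0" by (subst prob_Collect_eq_0) auto
      then show ?thesis using 1 by simp
    next
      case 2
      \<comment> \<open>The closed event at x lies in the open event at every u > x; let u decrease
        to x.\<close>
      have "prob {\<omega>\<in>space M. U \<omega> \<le> x} \<le> x"
      proof (rule dense_ge_bounded[OF 2(2)])
        fix u assume u: "x < u" "u < 1"
        have "prob {\<omega>\<in>space M. U \<omega> \<le> x} \<le> prob {\<omega>\<in>space M. U \<omega> < u}"
          using u by (intro finite_measure_mono) auto
        also have "\<dots> \<le> u" using u 2 by (intro le) auto
        finally show "prob {\<omega>\<in>space M. U \<omega> \<le> x} \<le> u" .
      qed
      moreover have "x \<le> prob {\<omega>\<in>space M. U \<omega> \<le> x}"
        using ge[of x] 2 by (cases "x = 0") auto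
      ultimately show ?thesis using 2 by simp
    next
      case 3
      have "AE \<omega> in M. U \<omega> \<le> x" using range by eventually_elim (use 3 in auto)
      then have "prob {\<omega>\<in>space M. U \<omega> \<le> x} = 1" by (subst prob_Collect_eq_1) auto
      then show ?thesis using 3 by simp
    qed
    then show "cdf (distr M borel U) x = cdf (uniform_measure lborel {0<..1}) x"
      using eq cdf_uniform_01 by simp
  qed
qed

lemma (in prob_space) AE_uniform_01:
  assumes "U \<in> borel_measurable M" "distr M borel U = uniform_measure lborel {0<..1::real}"
  shows "AE \<omega> in M. U \<omega> \<in> {0<..1}"
proof (rule AE_distrD[OF assms(1)])
  show "AE u in distr M borel U. u \<in> {0<..1}"
    unfolding assms(2) by (rule AE_uniform_measureI) auto
qed

lemma (in prob_space) prob_uniform_01: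
  assumes [measurable]: "U \<in> borel_measurable M"
    and "distr M borel U = uniform_measure lborel {0<..1::real}" "0 \<le> u" "u \<le> 1"
  shows "prob {\<omega>\<in>space M. U \<omega> \<le> u} = u"
  using cdf_distr_eq_prob[OF assms(1), of u] assms(3,4) by (simp add: assms(2) cdf_uniform_01)

text \<open>The first term is the left limit of the distribution function at x, the bracket is the
  atom at x: v selects a height within the jump.\<close>

definition distributional_transform :: "real measure \<Rightarrow> real \<Rightarrow> real \<Rightarrow> real" where
  "distributional_transform L x v = measure L {..<x} + v * (cdf L x - measure L {..<x})"

lemma (in real_distribution) measure_lessThan_mono: "mono (\<lambda>x. measure M {..<x})"
  by (auto intro!: monoI finite_measure_mono)

lemma (in real_distribution) measure_lessThan_le_cdf: "measure M {..<x} \<le> cdf M x"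
  unfolding cdf_def by (auto intro!: finite_measure_mono)

lemma (in real_distribution) cdf_le_measure_lessThan: "x < y \<Longrightarrow> cdf M x \<le> measure M {..<y}"
  unfolding cdf_def by (auto intro!: finite_measure_mono)

lemma (in real_distribution) distributional_transform_bounds:
  assumes "v \<in> {0..1}"
  shows "measure M {..<x} \<le> distributional_transform M x v" "distributional_transform M x v \<le> cdf M x"
  using measure_lessThan_le_cdf[of x] assms
    mult_right_mono[of v 1 "cdf M x - measure M {..<x}"]
  by (auto simp: distributional_transform_def)

text \<open>
  V spreads the mass of the atoms of T uniformly over the jumps of the distribution function, which
  makes the transform uniform even for discrete T.
\<close>

lemma (in prob_space) distributional_transform_uniform:
  fixes T V
  defines "L \<equiv> distr M borel T"
  defines "U \<equiv> \<lambda>\<omega>. distributional_transform L (T \<omega>) (V \<omega>)"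
  assumes indep: "indep_var borel T borel V"
    and V: "distr M borel V = uniform_measure lborel {0<..1}"
  shows "U \<in> borel_measurable M" "distr M borel U = uniform_measure lborel {0<..1}"
proof -
  have T [measurable]: "T \<in> borel_measurable M" and Vm [measurable]: "V \<in> borel_measurable M"
    using indep by (auto dest: indep_var_rv1 indep_var_rv2)
  interpret L: cdf_distribution L
    unfolding cdf_distribution_def L_def by simp
  have [measurable]: "(\<lambda>x. measure L {..<x}) \<in> borel_measurable borel"
    by (rule borel_measurable_mono[OF L.measure_lessThan_mono])
  show U [measurable]: "U \<in> borel_measurable M"
    unfolding U_def distributional_transform_def by measurable
  have V01: "AE \<omega> in M. V \<omega> \<in> {0<..1}" by (rule AE_uniform_01[OF Vm V])
  have L_lt: "prob {\<omega>\<in>space M. T \<omega> < x} = measure L {..<x}" for x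
    by (simp add: L_def measure_distr vimage_def Int_def conj_commute)
  have L_eq: "prob {\<omega>\<in>space M. T \<omega> = x} = cdf L x - measure L {..<x}" for x
  proof -
    have "cdf L x = measure L ({..<x} \<union> {x})"
      unfolding cdf_def by (rule arg_cong[of _ _ "measure L"]) auto
    also have "\<dots> = measure L {..<x} + measure L {x}"
      by (rule L.finite_measure_Union) auto
    finally have "cdf L x - measure L {..<x} = measure L {x}" by simp
    then show ?thesis by (simp add: L_def measure_distr vimage_def Int_def conj_commute)
  qed
  show "distr M borel U = uniform_measure lborel {0<..1}"
  proof (rule distr_eq_uniform_01[OF U])
    show "AE \<omega> in M. U \<omega> \<in> {0..1}"
      using V01
    proof eventually_elim
      case (elim \<omega>)
      have "0 \<le> measure L {..<T \<omega>}" "cdf L (T \<omega>) \<le> 1"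
        by (auto intro: L.cdf_bounded_prob)
      moreover have "V \<omega> \<in> {0..1}" using elim by simp
      ultimately show ?case
        using L.distributional_transform_bounds[of "V \<omega>" "T \<omega>"]
        unfolding U_def atLeastAtMost_iff by linarith
    qed
  next
    fix u :: real assume u: "0 < u" "u < 1"
    \<comment> \<open>The u-quantile of T, where the distribution function passes the level u,
      possibly by a jump from a to a + p.\<close>
    define s where "s = Inf {x. u \<le> cdf L x}"
    have s: "u \<le> cdf L x \<longleftrightarrow> s \<le> x" for x
      unfolding s_def by (rule L.pseudoinverse[OF u])
    define a where "a = measure L {..<s}"
    define p where "p = cdf L s - a"
    have "a \<le> u"
      unfolding a_def
    proof (rule tendsto_upperbound[OF L.cdf_at_left])
      have "cdf L x \<le> u" if "x < s" for x using s[of x] that by linarith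
      then show "\<forall>\<^sub>F x in at_left s. cdf L x \<le> u"
        by (auto simp: eventually_at_left_field intro!: exI[of _ "s - 1"])
    qed simp
    have "u \<le> a + p" using s[of s] by (simp add: p_def)
    \<comment> \<open>The relative height of u within the jump. If p = 0, then a = u, and division
      by zero yields c = 0, which still satisfies a + c * p = u.\<close>
    define c where "c = (u - a) / p"
    have c: "0 \<le> c" "c \<le> 1" "a + c * p = u"
      using \<open>a \<le> u\<close> \<open>u \<le> a + p\<close> by (auto simp: c_def divide_simps)
    \<comment> \<open>The event \<open>?A \<union> ?B\<close> has probability exactly u and lies, up
      to null sets, between U < u and U \<le> u. This gives both bounds.\<close>
    let ?A = "{\<omega>\<in>space M. T \<omega> < s}" and ?B = "{\<omega>\<in>space M. T \<omega> = s \<and> V \<omega> \<le> c}"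
    have "prob ?B = prob {\<omega>\<in>space M. T \<omega> = s} * prob {\<omega>\<in>space M. V \<omega> \<le> c}"
      using indep_varD[OF indep, of "{s}" "{..c}"]
      by (simp add: vimage_def Int_def conj_commute conj_left_commute)
    then have "prob ?B = c * p"
      using prob_uniform_01[OF Vm V c(1,2)] L_eq[of s] by (simp add: p_def a_def)
    moreover have "prob (?A \<union> ?B) = prob ?A + prob ?B"
      by (rule finite_measure_Union) auto
    ultimately have AB: "prob (?A \<union> ?B) = u"
      using L_lt[of s] c(3) by (simp add: a_def)
    have "prob (?A \<union> ?B) \<le> prob {\<omega>\<in>space M. U \<omega> \<le> u}"
    proof (rule finite_measure_mono_AE)
      show "AE \<omega> in M. \<omega> \<in> ?A \<union> ?B \<longrightarrow> \<omega> \<in> {\<omega>\<in>space M. U \<omega> \<le> u}"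
        using V01
      proof eventually_elim
        case (elim \<omega>)
        have "U \<omega> \<le> u" if "T \<omega> < s"
          using L.distributional_transform_bounds(2)[of "V \<omega>" "T \<omega>"] elim s[of "T \<omega>"] that
          unfolding U_def by auto
        moreover have "U \<omega> \<le> u" if "T \<omega> = s" "V \<omega> \<le> c"
        proof -
          have "V \<omega> * p \<le> c * p"
            using that L.measure_lessThan_le_cdf[of s]
            by (intro mult_right_mono) (auto simp: p_def a_def)
          then show ?thesis
            using c(3) that by (simp add: U_def distributional_transform_def p_def a_def)
        qed
        ultimately show ?case by auto
      qed
    qed simp
    then show "u \<le> prob {\<omega>\<in>space M. U \<omega> \<le> u}" by (simp only: AB)
    have "prob {\<omega>\<in>space M. U \<omega> < u} \<le> prob (?A \<union> ?B)"
    proof (rule finite_measure_mono_AE)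
      show "AE \<omega> in M. \<omega> \<in> {\<omega>\<in>space M. U \<omega> < u} \<longrightarrow> \<omega> \<in> ?A \<union> ?B"
        using V01
      proof eventually_elim
        case (elim \<omega>)
        have "u \<le> U \<omega>" if "s < T \<omega>"
          using L.distributional_transform_bounds(1)[of "V \<omega>" "T \<omega>"] elim s[of s]
            L.cdf_le_measure_lessThan[OF that] unfolding U_def by auto
        moreover have "u \<le> U \<omega>" if "T \<omega> = s" "c < V \<omega>"
        proof -
          have "c * p \<le> V \<omega> * p"
            using that L.measure_lessThan_le_cdf[of s]
            by (intro mult_right_mono) (auto simp: p_def a_def)
          then show ?thesis
            using c(3) that by (simp add: U_def distributional_transform_def p_def a_def)
        qed
        ultimately show ?case
          by (cases "T \<omega>" s rule: linorder_cases) (auto simp: linorder_not_less[symmetric])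
      qed
    qed simp
    then show "prob {\<omega>\<in>space M. U \<omega> < u} \<le> u" by (simp only: AB)
  qed
qed

section \<open>Quantile functions of variables with values in [0,1]\<close>

context prob_space
begin

context
  fixes X :: "'a \<Rightarrow> real"
  assumes X [measurable]: "X \<in> borel_measurable M" and X01: "AE \<omega> in M. X \<omega> \<in> {0..1}"
begin

lemma cdf_distr_at_1: "cdf (distr M borel X) 1 = 1"
  unfolding cdf_distr_eq_prob[OF X] using X01 by (subst prob_Collect_eq_1) auto

text \<open>Galois connection between quantile and distribution function. The nontrivial direction
  holds because right continuity makes the infimum attained; the set is nonempty since the
  distribution function is 1 at 1.\<close>

lemma quantile_le_iff:
  assumes p: "p \<le> 1" and y: "y \<in> {0..1}"
  shows "quantile M X p \<le> y \<longleftrightarrow> p \<le> cdf (distr M borel X) y"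
proof
  let ?F = "cdf (distr M borel X)"
  let ?A = "{x \<in> {0..1}. p \<le> ?F x}"
  interpret D: cdf_distribution "distr M borel X"
    unfolding cdf_distribution_def by simp
  have ne: "?A \<noteq> {}" using p cdf_distr_at_1 by force
  have bdd: "bdd_below ?A" by (rule bdd_belowI[of _ 0]) auto
  show "quantile M X p \<le> y" if "p \<le> ?F y"
    unfolding quantile_def using that y bdd by (intro cInf_lower) auto
  show "p \<le> ?F y" if "quantile M X p \<le> y"
  proof -
    have "p \<le> (INF x\<in>?A. ?F x)" by (rule cINF_greatest[OF ne]) auto
    also have "\<dots> = ?F (Inf ?A)"
      using continuous_at_Inf_mono[OF D.mono D.cont ne bdd] ..
    also have "\<dots> \<le> ?F y"
      using that unfolding quantile_def by (rule D.cdf_nondecreasing)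
    finally show ?thesis .
  qed
qed

lemma quantile_range:
  assumes "p \<le> 1"
  shows "quantile M X p \<in> {0..1}"
proof -
  have "quantile M X p \<le> 1" using quantile_le_iff[OF assms, of 1] cdf_distr_at_1 assms by simp
  moreover have "{x \<in> {0..1}. p \<le> cdf (distr M borel X) x} \<noteq> {}"
    using assms cdf_distr_at_1 by force
  then have "0 \<le> quantile M X p" unfolding quantile_def by (intro cInf_greatest) auto
  ultimately show ?thesis by simp
qed

lemma borel_measurable_quantile: "quantile M X \<in> borel_measurable borel"
proof -
  interpret D: real_distribution "distr M borel X" by simp
  \<comment> \<open>For p > 1 the quantile is the infimum of the empty set, an unspecified constant.\<close>
  have eq: "quantile M X p = (if p \<le> 1 then quantile M X (min p 1) else Inf {})" for p
  proof -
    have "{x \<in> {0..1}. p \<le> cdf (distr M borel X) x} = {}" if "1 < p"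
      using that D.cdf_bounded_prob by (smt (verit) empty_Collect_eq)
    then have "quantile M X p = Inf {}" if "1 < p" using that by (simp only: quantile_def)
    then show ?thesis by simp
  qed
  have "mono (\<lambda>p. quantile M X (min p 1))"
  proof (rule monoI)
    fix p q :: real assume "p \<le> q"
    have "min q 1 \<le> cdf (distr M borel X) (quantile M X (min q 1))"
      using quantile_le_iff[of "min q 1" "quantile M X (min q 1)"] quantile_range[of "min q 1"] by simp
    then have "min p 1 \<le> cdf (distr M borel X) (quantile M X (min q 1))" using \<open>p \<le> q\<close> by simp
    then show "quantile M X (min p 1) \<le> quantile M X (min q 1)"
      using quantile_le_iff[of "min p 1" "quantile M X (min q 1)"] quantile_range[of "min q 1"] by simp
  qed
  then have [measurable]: "(\<lambda>p. quantile M X (min p 1)) \<in> borel_measurable borel"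
    by (rule borel_measurable_mono)
  show ?thesis by (subst eq[abs_def]) measurable
qed

lemma stop_loss_0: "stop_loss M X 0 = expectation X"
proof -
  have "stop_loss M X 0 = expectation (\<lambda>\<omega>. max (X \<omega> - 0) 0)"
    using X01 by (intro stop_loss_eq_expectation) auto
  also have "\<dots> = expectation X" using X01 by (intro integral_cong_AE) auto
  finally show ?thesis .
qed

end

text \<open>By the Galois connection the quantile at U has the distribution function of X on [0,1],
  and the stop-loss transform at 0 recovers the mean from these values.\<close>

lemma expectation_quantile:
  assumes X [measurable]: "X \<in> borel_measurable M" and X01: "AE \<omega> in M. X \<omega> \<in> {0..1}"
    and U [measurable]: "U \<in> borel_measurable M" and unif: "distr M borel U = uniform_measure lborel {0<..1}"
  shows "expectation (\<lambda>\<omega>. quantile M X (U \<omega>)) = expectation X"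
proof -
  let ?Q = "\<lambda>\<omega>. quantile M X (U \<omega>)"
  have Q [measurable]: "?Q \<in> borel_measurable M"
    using borel_measurable_quantile[OF X X01] by measurable
  have U01: "AE \<omega> in M. U \<omega> \<in> {0<..1}" by (rule AE_uniform_01[OF U unif])
  then have Q01: "AE \<omega> in M. ?Q \<omega> \<in> {0..1}"
    by eventually_elim (intro quantile_range[OF X X01], simp)
  interpret D: real_distribution "distr M borel X" by simp
  have "cdf (distr M borel ?Q) y = cdf (distr M borel X) y" if y: "y \<in> {0..1}" for y
  proof -
    have "cdf (distr M borel ?Q) y = prob {\<omega>\<in>space M. ?Q \<omega> \<le> y}"
      by (rule cdf_distr_eq_prob[OF Q])
    also have "\<dots> = prob {\<omega>\<in>space M. U \<omega> \<le> cdf (distr M borel X) y}"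
    proof (rule finite_measure_eq_AE)
      show "AE \<omega> in M. (\<omega> \<in> {\<omega>\<in>space M. ?Q \<omega> \<le> y}) =
          (\<omega> \<in> {\<omega>\<in>space M. U \<omega> \<le> cdf (distr M borel X) y})"
        using U01 by eventually_elim (use quantile_le_iff[OF X X01 _ y] in auto)
    qed auto
    also have "\<dots> = cdf (distr M borel X) y"
      by (rule prob_uniform_01[OF U unif D.cdf_nonneg D.cdf_bounded_prob])
    finally show ?thesis .
  qed
  then have "stop_loss M ?Q 0 = stop_loss M X 0"
    unfolding stop_loss_def set_lebesgue_integral_def
    by (intro Bochner_Integration.integral_cong) (auto simp: indicator_def)
  then show ?thesis using stop_loss_0[OF X X01] stop_loss_0[OF Q Q01] by simp
qed

text \<open>The same U works for every nondecreasing w, which is what makes the components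
  comonotone. One inequality is pointwise: U is at most the distribution function of T at T, hence
  at most that of w(T) at w(T), as T' \<le> T implies w(T') \<le> w(T).\<close>

lemma AE_quantile_distributional_transform:
  fixes T V
  defines "U \<equiv> \<lambda>\<omega>. distributional_transform (distr M borel T) (T \<omega>) (V \<omega>)"
  assumes indep: "indep_var borel T borel V"
    and V: "distr M borel V = uniform_measure lborel {0<..1}"
    and w: "mono w" "\<And>s. w s \<in> {0..1}"
  shows "AE \<omega> in M. quantile M (\<lambda>\<omega>. w (T \<omega>)) (U \<omega>) = w (T \<omega>)"
proof -
  have T [measurable]: "T \<in> borel_measurable M" and Vm [measurable]: "V \<in> borel_measurable M"
    using indep by (auto dest: indep_var_rv1 indep_var_rv2)
  have [measurable]: "w \<in> borel_measurable borel" by (rule borel_measurable_mono[OF w(1)])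
  let ?X = "\<lambda>\<omega>. w (T \<omega>)"
  let ?Q = "\<lambda>\<omega>. quantile M ?X (U \<omega>)"
  note U [measurable] = distributional_transform_uniform(1)[OF indep V, folded U_def]
  note unif = distributional_transform_uniform(2)[OF indep V, folded U_def]
  have X: "?X \<in> borel_measurable M" by simp
  have X01: "AE \<omega> in M. ?X \<omega> \<in> {0..1}" using w by simp
  have Q [measurable]: "?Q \<in> borel_measurable M"
    using borel_measurable_quantile[OF X X01] by measurable
  have U01: "AE \<omega> in M. U \<omega> \<in> {0<..1}" by (rule AE_uniform_01[OF U unif])
  then have Q01: "AE \<omega> in M. ?Q \<omega> \<in> {0..1}"
    by eventually_elim (intro quantile_range[OF X X01], simp)
  have int: "integrable M ?Q" "integrable M ?X"
    using Q01 X01 by (auto intro!: integrable_const_bound[where B = 1])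
  interpret L: real_distribution "distr M borel T" by simp
  have le: "AE \<omega> in M. ?Q \<omega> \<le> ?X \<omega>"
    using U01 AE_uniform_01[OF Vm V]
  proof eventually_elim
    case (elim \<omega>)
    have "U \<omega> \<le> cdf (distr M borel T) (T \<omega>)"
      unfolding U_def using elim by (intro L.distributional_transform_bounds) auto
    also have "\<dots> = prob {\<omega>'\<in>space M. T \<omega>' \<le> T \<omega>}"
      by (rule cdf_distr_eq_prob[OF T])
    also have "\<dots> \<le> prob {\<omega>'\<in>space M. ?X \<omega>' \<le> ?X \<omega>}"
      using w(1) by (intro finite_measure_mono) (auto dest: monoD)
    also have "\<dots> = cdf (distr M borel ?X) (?X \<omega>)"
      by (rule cdf_distr_eq_prob[OF X, symmetric])
    finally show ?case using quantile_le_iff[OF X X01] elim w(2) by auto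
  qed
  \<comment> \<open>The converse inequality can fail on a null set; it follows from equality of the means.\<close>
  have "expectation (\<lambda>\<omega>. ?X \<omega> - ?Q \<omega>) = 0"
    using int expectation_quantile[OF X X01 U unif] by simp
  then have "AE \<omega> in M. ?X \<omega> - ?Q \<omega> = 0"
    using le int by (subst (asm) integral_nonneg_eq_0_iff_AE) auto
  then show ?thesis by eventually_elim simp
qed

end

subsection \<open>The four conditions\<close>

locale decomposition_problem = prob_space M for M :: "'a measure" +
  fixes S :: "'a \<Rightarrow> real" and n :: nat and h \<alpha> :: "nat \<Rightarrow> real"
  assumes n: "n \<ge> 1"
    and h_pos: "\<forall>k\<in>{1..n}. h k > 0"
    and h_sum: "(\<Sum>k=1..n. h k) = 1"
    and \<alpha>_le: "\<alpha> 1 \<le> 1"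
    and \<alpha>_dec: "strict_antimono_on {1..n} \<alpha>"
    and \<alpha>_pos: "\<alpha> n > 0"
    and S [measurable]: "S \<in> borel_measurable M"
    and S_supp: "AE \<omega> in M. S \<omega> \<in> {0..1}"
    and S_mean: "(LINT \<omega>|M. S \<omega>) = (\<Sum>k=1..n. h k * \<alpha> k)"
begin

lemma partial_sum_n: "partial_sum h n = 1"
  using h_sum by (simp add: partial_sum_def)

lemma partial_sum_lt_1: "k < n \<Longrightarrow> partial_sum h k < 1"
proof -
  assume k: "k < n"
  have "0 < (\<Sum>i=k+1..n. h i)" using k h_pos by (intro sum_pos) auto
  then show ?thesis using partial_sum_split[of k n h] k partial_sum_n by simp
qed

lemma partial_sum_nonneg: "k \<le> n \<Longrightarrow> 0 \<le> partial_sum h k"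
  using partial_sum_mono[of n h 0 k] h_pos by (auto simp: less_imp_le)

lemma integrable_max: "integrable M (\<lambda>\<omega>. max (S \<omega> - c) 0)"
proof (rule integrable_const_bound[where B = "1 + \<bar>c\<bar>"])
  show "AE \<omega> in M. norm (max (S \<omega> - c) 0) \<le> 1 + \<bar>c\<bar>"
    using S_supp by eventually_elim auto
qed simp

lemma integrable_S: "integrable M S"
  using S_supp by (auto intro!: integrable_const_bound[where B = 1])

definition stop_loss_bounded :: bool where
  "stop_loss_bounded \<longleftrightarrow> (\<forall>k\<in>{1..n-1}.
     expectation (\<lambda>\<omega>. max (S \<omega> - partial_sum h k) 0) \<le> (\<Sum>i=k+1..n. h i * \<alpha> i))"

lemma stop_loss_bounded_iff:
  "stop_loss_bounded \<longleftrightarrow> (\<forall>k\<in>{1..n-1}. stop_loss M S (partial_sum h k)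
     \<le> (1 - partial_sum h k) * tail_mean n h \<alpha> k)"
proof -
  have "stop_loss M S (partial_sum h k) = expectation (\<lambda>\<omega>. max (S \<omega> - partial_sum h k) 0)" for k
    using S_supp by (intro stop_loss_eq_expectation) auto
  moreover have "(1 - partial_sum h k) * tail_mean n h \<alpha> k = (\<Sum>i=k+1..n. h i * \<alpha> i)"
    if "k \<in> {1..n-1}" for k
  proof -
    have "k < n" using that n by auto
    then show ?thesis using partial_sum_lt_1[of k] by (simp add: tail_mean_def)
  qed
  ultimately show ?thesis unfolding stop_loss_bounded_def by simp
qed

lemma greedy_is_filling: "filling n h (greedy h)"
  using filling_greedy[OF h_pos partial_sum_n] .

text \<open>The truncation \<open>min s c\<close> equals \<open>s - max (s - c) 0\<close>, so prefix
  means of the greedy filling and stop-loss values determine each other.\<close>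

lemma sum_expectation_greedy:
  assumes "k \<le> n"
  shows "(\<Sum>i=1..k. h i * expectation (\<lambda>\<omega>. greedy h i (S \<omega>))) =
    expectation S - expectation (\<lambda>\<omega>. max (S \<omega> - partial_sum h k) 0)"
proof -
  have int: "integrable M (\<lambda>\<omega>. greedy h i (S \<omega>))" if "i \<in> {1..k}" for i
    using integrable_filling[OF greedy_is_filling S, of i] that assms by auto
  then have "(\<Sum>i=1..k. h i * expectation (\<lambda>\<omega>. greedy h i (S \<omega>))) =
      expectation (\<lambda>\<omega>. \<Sum>i=1..k. h i * greedy h i (S \<omega>))"
    by (subst Bochner_Integration.integral_sum) auto
  also have "\<dots> = expectation (\<lambda>\<omega>. S \<omega> - max (S \<omega> - partial_sum h k) 0)"
  proof (rule integral_cong_AE)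
    show "AE \<omega> in M. (\<Sum>i=1..k. h i * greedy h i (S \<omega>)) = S \<omega> - max (S \<omega> - partial_sum h k) 0"
      using S_supp
    proof eventually_elim
      case (elim \<omega>)
      then show ?case using sum_greedy[of k h "S \<omega>"] h_pos assms by auto
    qed
    show "(\<lambda>\<omega>. \<Sum>i=1..k. h i * greedy h i (S \<omega>)) \<in> borel_measurable M"
      by (rule borel_measurable_integrable) (use int in auto)
  qed simp
  also have "\<dots> = expectation S - expectation (\<lambda>\<omega>. max (S \<omega> - partial_sum h k) 0)"
    by (rule Bochner_Integration.integral_diff[OF integrable_S integrable_max])
  finally show ?thesis .
qed

lemma greedy_total:
  "(\<Sum>i=1..n. h i * \<alpha> i) = (\<Sum>i=1..n. h i * expectation (\<lambda>\<omega>. greedy h i (S \<omega>)))"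
proof -
  have "expectation (\<lambda>\<omega>. max (S \<omega> - 1) 0) = expectation (\<lambda>\<omega>. 0)"
    using S_supp by (intro integral_cong_AE) auto
  then show ?thesis using sum_expectation_greedy[of n] partial_sum_n S_mean by simp
qed

text \<open>The mean of S is the total of \<open>h i * \<alpha> i\<close>, so bounding a stop-loss
  value by a tail sum is bounding a greedy prefix from below by the complementary sum. The ends k =
  0 and k = n are equalities.\<close>

lemma greedy_dominates:
  assumes "stop_loss_bounded"
  shows "\<forall>k\<le>n. (\<Sum>i=1..k. h i * \<alpha> i) \<le> (\<Sum>i=1..k. h i * expectation (\<lambda>\<omega>. greedy h i (S \<omega>)))"
proof (intro allI impI)
  fix k assume k: "k \<le> n"
  show "(\<Sum>i=1..k. h i * \<alpha> i) \<le> (\<Sum>i=1..k. h i * expectation (\<lambda>\<omega>. greedy h i (S \<omega>)))"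
  proof (cases "k \<in> {1..n-1}")
    case True
    then have "expectation (\<lambda>\<omega>. max (S \<omega> - partial_sum h k) 0) \<le> (\<Sum>i=k+1..n. h i * \<alpha> i)"
      using assms by (auto simp: stop_loss_bounded_def)
    moreover have "(\<Sum>i=1..n. h i * \<alpha> i) = (\<Sum>i=1..k. h i * \<alpha> i) + (\<Sum>i=k+1..n. h i * \<alpha> i)"
      using partial_sum_split[OF k, of "\<lambda>i. h i * \<alpha> i"] by (simp add: partial_sum_def)
    ultimately show ?thesis using sum_expectation_greedy[OF k] S_mean by simp
  next
    case False
    with k have "k = 0 \<or> k = n" by auto
    then show ?thesis using greedy_total by auto
  qed
qed

section \<open>The implications between the four conditions\<close>

text \<open>As every component is at most 1, the first k contribute at most
  \<open>partial_sum h k\<close>; any excess of S over that level is covered by the later,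
  nonnegative ones.\<close>

lemma decomposable_imp_stop_loss_bounded:
  assumes "decomposable M n h \<alpha> S"
  shows "stop_loss_bounded"
  unfolding stop_loss_bounded_def
proof
  fix k assume k: "k \<in> {1..n-1}"
  obtain N W where N: "enrichment M N" and W: "decomposes N n h \<alpha> (\<lambda>\<omega>. S (fst \<omega>)) W"
    using assms by (auto simp: decomposable_def)
  interpret N: prob_space N using N by (simp add: enrichment_def)
  have fst [measurable]: "fst \<in> measurable N M" and distr: "distr N M fst = M"
    using N by (simp_all add: enrichment_def)
  have Wk: "W i \<in> borel_measurable N" "AE \<omega> in N. W i \<omega> \<in> {0..1}" "N.expectation (W i) = \<alpha> i"
    if "i \<in> {1..n}" for i using W that by (auto simp: decomposes_def)
  have int: "integrable N (W i)" if "i \<in> {1..n}" for i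
    using Wk(1,2)[OF that] by (auto intro!: N.integrable_const_bound[where B = 1])
  have W01: "AE \<omega> in N. \<forall>i\<in>{1..n}. W i \<omega> \<in> {0..1}"
    using Wk(2) by (intro AE_finite_allI) auto
  have SW: "AE \<omega> in N. S (fst \<omega>) = (\<Sum>i=1..n. h i * W i \<omega>)"
    using W by (simp add: decomposes_def)
  have "expectation (\<lambda>\<omega>. max (S \<omega> - partial_sum h k) 0) =
      (LINT \<omega>|distr N M fst. max (S \<omega> - partial_sum h k) 0)" by (simp only: distr)
  also have "\<dots> = N.expectation (\<lambda>\<omega>. max (S (fst \<omega>) - partial_sum h k) 0)"
    by (rule integral_distr[OF fst]) simp
  also have "\<dots> \<le> N.expectation (\<lambda>\<omega>. \<Sum>i=k+1..n. h i * W i \<omega>)"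
  proof (rule integral_mono_AE)
    show "integrable N (\<lambda>\<omega>. max (S (fst \<omega>) - partial_sum h k) 0)"
      using integrable_distr_eq[OF fst, of "\<lambda>\<omega>. max (S \<omega> - partial_sum h k) 0"]
        integrable_max distr by simp
    show "integrable N (\<lambda>\<omega>. \<Sum>i=k+1..n. h i * W i \<omega>)" using int by auto
    show "AE \<omega> in N. max (S (fst \<omega>) - partial_sum h k) 0 \<le> (\<Sum>i=k+1..n. h i * W i \<omega>)"
      using W01 SW
    proof eventually_elim
      case (elim \<omega>)
      have "(\<Sum>i=1..n. h i * W i \<omega>) = (\<Sum>i=1..k. h i * W i \<omega>) + (\<Sum>i=k+1..n. h i * W i \<omega>)"
        using partial_sum_split[of k n "\<lambda>i. h i * W i \<omega>"] k by (auto simp: partial_sum_def)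
      moreover have "(\<Sum>i=1..k. h i * W i \<omega>) \<le> partial_sum h k"
        unfolding partial_sum_def using k h_pos elim(1)
        by (intro sum_mono mult_left_le) (auto simp: less_imp_le)
      moreover have "0 \<le> (\<Sum>i=k+1..n. h i * W i \<omega>)"
        using k h_pos elim(1) by (intro sum_nonneg mult_nonneg_nonneg) (auto simp: less_imp_le)
      ultimately show ?case using elim(2) by simp
    qed
  qed
  also have "\<dots> = (\<Sum>i=k+1..n. h i * \<alpha> i)"
    using int Wk(3) by (subst Bochner_Integration.integral_sum) auto
  finally show "expectation (\<lambda>\<omega>. max (S \<omega> - partial_sum h k) 0) \<le> (\<Sum>i=k+1..n. h i * \<alpha> i)" .
qed

lemma stop_loss_bounded_imp_convex_le:
  assumes "stop_loss_bounded"
  shows "convex_le M S (max_convex_space n \<alpha>) (max_convex_var h)"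
  unfolding convex_le_def
proof (intro allI impI)
  fix f :: "real \<Rightarrow> real"
  assume f: "convex_on UNIV f" and int_f: "integrable M (\<lambda>\<omega>. f (S \<omega>))"
  define \<beta> where "\<beta> i = expectation (\<lambda>\<omega>. greedy h i (S \<omega>))" for i
  define \<Delta> where "\<Delta> i = f (partial_sum h i) - f (partial_sum h (i - 1))" for i
  have int: "integrable M (\<lambda>\<omega>. greedy h i (S \<omega>))" if "i \<in> {1..n}" for i
    using integrable_filling[OF greedy_is_filling S that] .
  then have int': "integrable M (\<lambda>\<omega>. \<Sum>i=1..n. greedy h i (S \<omega>) * \<Delta> i)" by auto
  have "expectation (\<lambda>\<omega>. f (S \<omega>)) \<le> expectation (\<lambda>\<omega>. f 0 + (\<Sum>i=1..n. greedy h i (S \<omega>) * \<Delta> i))"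
  proof (rule integral_mono_AE[OF int_f])
    show "AE \<omega> in M. f (S \<omega>) \<le> f 0 + (\<Sum>i=1..n. greedy h i (S \<omega>) * \<Delta> i)"
      using S_supp
    proof eventually_elim
      case (elim \<omega>)
      then show ?case
        using convex_on_le_greedy[OF f h_pos, of "S \<omega>"] partial_sum_n by (simp add: \<Delta>_def)
    qed
  qed (use int' in auto)
  also have "\<dots> = f 0 + (\<Sum>i=1..n. \<beta> i * \<Delta> i)"
    using int int' by (simp add: prob_space \<beta>_def)
  \<comment> \<open>Dividing by \<open>h i\<close> turns increments into slopes: convexity makes the
    slopes nondecreasing, while the increments over intervals of unequal length need not be.\<close>
  also have "(\<Sum>i=1..n. \<beta> i * \<Delta> i) = (\<Sum>i=1..n. \<beta> i * (h i * (\<Delta> i / h i)))"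
    using h_pos by (intro sum.cong) (auto dest!: bspec)
  also have "\<dots> \<le> (\<Sum>i=1..n. \<alpha> i * (h i * (\<Delta> i / h i)))"
  proof (rule abel_sum_le)
    fix k assume k: "1 \<le> k" "k < n"
    define x y z where "x = partial_sum h (k - 1)" and "y = partial_sum h k"
      and "z = partial_sum h (Suc k)"
    have "h k > 0" "h (Suc k) > 0" using k h_pos by auto
    moreover have hk: "h k = y - x" "h (Suc k) = z - y"
      using k partial_sum_Suc[of h "k - 1"] by (simp_all add: x_def y_def z_def)
    ultimately have "x < y" "y < z" by auto
    then have "(f x - f y) / (x - y) \<le> (f y - f z) / (y - z)"
      using convex_on_slope_le[OF f, of x z y] by simp
    then have "(f y - f x) / (y - x) \<le> (f z - f y) / (z - y)"
      by (metis minus_diff_eq minus_divide_divide)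
    then show "\<Delta> k / h k \<le> \<Delta> (Suc k) / h (Suc k)"
      unfolding hk by (simp add: \<Delta>_def x_def y_def z_def)
  qed (use greedy_dominates[OF assms] greedy_total in \<open>simp_all add: \<beta>_def\<close>)
  also have "\<dots> = (\<Sum>i=1..n. \<alpha> i * \<Delta> i)"
    using h_pos by (intro sum.cong) (auto dest!: bspec)
  also have "f 0 + \<dots> = (LINT k|max_convex_space n \<alpha>. f (max_convex_var h k))"
    using expectation_max_convex[OF \<alpha>_le \<alpha>_dec \<alpha>_pos n, of f h] by (simp add: \<Delta>_def)
  finally show "expectation (\<lambda>\<omega>. f (S \<omega>)) \<le> (LINT k|max_convex_space n \<alpha>. f (max_convex_var h k))"
    by simp
qed

text \<open>Test with the convex function (x - H_k)_+: its increments along the grid are 0 up to k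
  and \<open>h i\<close> afterwards, so its mean under the maximally convex variable is exactly the
  bound in the stop-loss condition.\<close>

lemma convex_le_imp_stop_loss_bounded:
  assumes "convex_le M S (max_convex_space n \<alpha>) (max_convex_var h)"
  shows "stop_loss_bounded"
  unfolding stop_loss_bounded_def
proof
  fix k assume k: "k \<in> {1..n-1}"
  define f :: "real \<Rightarrow> real" where "f x = max (x - partial_sum h k) 0" for x
  have "convex_on UNIV f"
  proof (rule convex_onI)
    fix t x y :: real
    assume t: "0 < t" "t < 1"
    have "(1 - t) * (x - partial_sum h k) \<le> (1 - t) * f x" "t * (y - partial_sum h k) \<le> t * f y"
      "0 \<le> (1 - t) * f x" "0 \<le> t * f y"
      using t by (auto simp: f_def)
    moreover have "(1 - t) * x + t * y - partial_sum h k =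
        (1 - t) * (x - partial_sum h k) + t * (y - partial_sum h k)"
      by (simp add: algebra_simps)
    ultimately show "f ((1 - t) *\<^sub>R x + t *\<^sub>R y) \<le> (1 - t) * f x + t * f y"
      unfolding f_def[of "(1 - t) *\<^sub>R x + t *\<^sub>R y"] by simp
  qed simp
  moreover have "integrable (max_convex_space n \<alpha>) (\<lambda>k. f (max_convex_var h k))"
    unfolding max_convex_space_def by (rule integrable_point_measure_finite) simp
  moreover have "integrable M (\<lambda>\<omega>. f (S \<omega>))" unfolding f_def by (rule integrable_max)
  ultimately have "expectation (\<lambda>\<omega>. f (S \<omega>)) \<le> (LINT k|max_convex_space n \<alpha>. f (max_convex_var h k))"
    using assms by (simp add: convex_le_def)
  also have "\<dots> = f 0 + (\<Sum>i=1..n. \<alpha> i * (f (partial_sum h i) - f (partial_sum h (i - 1))))"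
    by (rule expectation_max_convex[OF \<alpha>_le \<alpha>_dec \<alpha>_pos n])
  also have "f 0 = 0" using partial_sum_nonneg[of k] k by (auto simp: f_def max_def)
  also have "(\<Sum>i=1..n. \<alpha> i * (f (partial_sum h i) - f (partial_sum h (i - 1)))) =
      (\<Sum>i=k+1..n. \<alpha> i * (f (partial_sum h i) - f (partial_sum h (i - 1))))"
  proof (rule sum.mono_neutral_right)
    show "\<forall>i\<in>{1..n} - {k+1..n}. \<alpha> i * (f (partial_sum h i) - f (partial_sum h (i - 1))) = 0"
    proof
      fix i assume i: "i \<in> {1..n} - {k+1..n}"
      have "f (partial_sum h j) = 0" if "j \<le> k" for j
        using partial_sum_mono[of n h j k] h_pos k that by (auto simp: f_def less_imp_le)
      moreover have "i \<le> k" "i - 1 \<le> k" using i by auto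
      ultimately show "\<alpha> i * (f (partial_sum h i) - f (partial_sum h (i - 1))) = 0" by simp
    qed
  qed auto
  also have "\<dots> = (\<Sum>i=k+1..n. h i * \<alpha> i)"
  proof (rule sum.cong[OF refl])
    fix i assume i: "i \<in> {k+1..n}"
    have f_eq: "f (partial_sum h j) = partial_sum h j - partial_sum h k" if "k \<le> j" "j \<le> n" for j
      using partial_sum_mono[of n h k j] h_pos that by (auto simp: f_def less_imp_le)
    have "partial_sum h i = partial_sum h (i - 1) + h i"
      using i partial_sum_Suc[of h "i - 1"] by simp
    moreover have "f (partial_sum h i) = partial_sum h i - partial_sum h k"
      "f (partial_sum h (i - 1)) = partial_sum h (i - 1) - partial_sum h k"
      using i by (auto intro!: f_eq)
    ultimately show "\<alpha> i * (f (partial_sum h i) - f (partial_sum h (i - 1))) = h i * \<alpha> i"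
      by (simp only:) simp
  qed
  finally show "expectation (\<lambda>\<omega>. max (S \<omega> - partial_sum h k) 0) \<le> (\<Sum>i=k+1..n. h i * \<alpha> i)"
    by (simp add: f_def)
qed

lemma comonotonically_decomposable_imp_decomposable:
  assumes "comonotonically_decomposable M n h \<alpha> S"
  shows "decomposable M n h \<alpha> S"
proof -
  obtain N U X where "enrichment M N"
    "decomposes N n h \<alpha> (\<lambda>\<omega>. S (fst \<omega>)) (\<lambda>k \<omega>. quantile N (X k) (U \<omega>))"
    using assms unfolding comonotonically_decomposable_def by blast
  then show ?thesis unfolding decomposable_def by (intro exI conjI)
qed

lemma stop_loss_bounded_imp_comonotonically_decomposable:
  assumes "stop_loss_bounded"
  shows "comonotonically_decomposable M n h \<alpha> S"
proof -
  have "antimono_on {1..n} \<alpha>"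
    using \<alpha>_dec by (auto simp: monotone_on_def order.order_iff_strict)
  then obtain w where w: "filling n h w" "\<forall>k\<in>{1..n}. expectation (\<lambda>\<omega>. w k (S \<omega>)) = \<alpha> k"
    using ex_filling_expectation[OF S h_pos _ greedy_is_filling greedy_dominates[OF assms] greedy_total]
    by blast
  have wk: "mono (w k)" "\<And>s. w k s \<in> {0..1}" if "k \<in> {1..n}" for k
    using w(1) that by (auto simp: filling_def)
  \<comment> \<open>An i.i.d. uniform sequence matches the auxiliary space fixed by
    \<open>enrichment\<close>; coordinate 0 becomes V, independent of S on the product.\<close>
  define K where "K = PiM (UNIV :: nat set) (\<lambda>_. uniform_measure lborel {0<..1::real})"
  have unif: "prob_space (uniform_measure lborel {0<..1::real})"
    by (intro prob_space_uniform_measure) auto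
  interpret K: prob_space K unfolding K_def using unif by (intro prob_space_PiM)
  have K0 [measurable]: "(\<lambda>v. v 0) \<in> borel_measurable K"
    unfolding K_def using measurable_component_singleton[of "0::nat" UNIV "\<lambda>_. uniform_measure lborel {0<..1::real}"]
    by (simp cong: measurable_cong_sets)
  have K0_distr: "distr K borel (\<lambda>v. v 0) = uniform_measure lborel {0<..1}"
    using distr_PiM_component[of UNIV "\<lambda>_. uniform_measure lborel {0<..1::real}" "0::nat"] unif
    unfolding K_def by (simp cong: distr_cong)
  define N where "N = M \<Otimes>\<^sub>M K"
  interpret N: pair_prob_space M K ..
  interpret N: prob_space N unfolding N_def by (rule N.prob_space_axioms)
  have fst [measurable]: "fst \<in> measurable N M" and snd [measurable]: "snd \<in> measurable N K"
    unfolding N_def by simp_all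
  have distr_fst: "distr N M fst = M" unfolding N_def by (rule K.distr_pair_fst)
  have enrich: "enrichment M N"
    using N.prob_space_axioms fst distr_fst by (simp add: enrichment_def)
  define T where "T = (\<lambda>\<omega>::'a \<times> (nat \<Rightarrow> real). S (fst \<omega>))"
  define V where "V = (\<lambda>\<omega>::'a \<times> (nat \<Rightarrow> real). snd \<omega> 0)"
  have T [measurable]: "T \<in> borel_measurable N" unfolding T_def by simp
  have V [measurable]: "V \<in> borel_measurable N" unfolding V_def by measurable
  have T_distr: "distr N borel T = distr M borel S"
    using distr_distr[OF S fst] distr_fst by (simp add: T_def comp_def)
  have V_distr': "distr N borel V = distr K borel (\<lambda>v. v 0)"
  proof -
    have "distr N K snd = K"
    proof (rule measure_eqI)
      fix A assume "A \<in> sets (distr N K snd)"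
      then have A: "A \<in> sets K" by simp
      then have "snd -` A \<inter> space N = space M \<times> A"
        using sets.sets_into_space[OF A] by (auto simp: N_def space_pair_measure)
      then show "emeasure (distr N K snd) A = emeasure K A"
        using A by (simp add: emeasure_distr N_def K.emeasure_pair_measure_Times emeasure_space_1)
    qed simp
    then show ?thesis using distr_distr[OF K0 snd] by (simp add: V_def comp_def)
  qed
  have V_distr: "distr N borel V = uniform_measure lborel {0<..1}"
    using V_distr' K0_distr by simp
  have indep: "N.indep_var borel T borel V"
    unfolding N.indep_var_distribution_eq
  proof (intro conjI T V)
    have "distr M borel S \<Otimes>\<^sub>M distr K borel (\<lambda>v. v 0) =
        distr (M \<Otimes>\<^sub>M K) (borel \<Otimes>\<^sub>M borel) (\<lambda>(x, y). (S x, y 0))"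
    proof (rule pair_measure_distr[OF S K0])
      show "sigma_finite_measure (distr K borel (\<lambda>v. v 0))"
        using K.prob_space_distr[OF K0] by (rule prob_space_imp_sigma_finite)
    qed
    then show "distr N borel T \<Otimes>\<^sub>M distr N borel V = distr N (borel \<Otimes>\<^sub>M borel) (\<lambda>\<omega>. (T \<omega>, V \<omega>))"
      unfolding T_distr V_distr' by (simp add: N_def T_def V_def case_prod_beta')
  qed
  \<comment> \<open>The variables whose quantiles are taken at U are
    \<open>w k (T \<omega>)\<close>; their quantiles at U give back these values almost surely, so
    the filling identity at S becomes the required decomposition.\<close>
  define U where "U = (\<lambda>\<omega>. distributional_transform (distr N borel T) (T \<omega>) (V \<omega>))"
  note U = N.distributional_transform_uniform[OF indep V_distr, folded U_def]
  have X: "(\<lambda>\<omega>. w k (T \<omega>)) \<in> borel_measurable N" if "k \<in> {1..n}" for k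
    using filling_measurable[OF w(1) that] T by measurable
  have Q: "AE \<omega> in N. quantile N (\<lambda>\<omega>. w k (T \<omega>)) (U \<omega>) = w k (T \<omega>)" if "k \<in> {1..n}" for k
    unfolding U_def by (rule N.AE_quantile_distributional_transform[OF indep V_distr wk[OF that]])
  have Qm: "(\<lambda>\<omega>. quantile N (\<lambda>\<omega>. w k (T \<omega>)) (U \<omega>)) \<in> borel_measurable N" if "k \<in> {1..n}" for k
    using N.borel_measurable_quantile[OF X[OF that]] wk(2)[OF that] U(1) by simp
  have "decomposes N n h \<alpha> (\<lambda>\<omega>. S (fst \<omega>)) (\<lambda>k \<omega>. quantile N (\<lambda>\<omega>. w k (T \<omega>)) (U \<omega>))"
    unfolding decomposes_def
  proof (intro conjI ballI)
    fix k assume k: "k \<in> {1..n}"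
    show "(\<lambda>\<omega>. quantile N (\<lambda>\<omega>. w k (T \<omega>)) (U \<omega>)) \<in> borel_measurable N" by (rule Qm[OF k])
    show "AE \<omega> in N. quantile N (\<lambda>\<omega>. w k (T \<omega>)) (U \<omega>) \<in> {0..1}"
      using Q[OF k] by eventually_elim (use wk(2)[OF k] in simp)
    have "N.expectation (\<lambda>\<omega>. quantile N (\<lambda>\<omega>. w k (T \<omega>)) (U \<omega>)) = N.expectation (\<lambda>\<omega>. w k (T \<omega>))"
      using Q[OF k] by (intro integral_cong_AE Qm X k)
    also have "\<dots> = (LINT s|distr N borel T. w k s)"
      by (rule integral_distr[OF T filling_measurable[OF w(1) k], symmetric])
    also have "\<dots> = expectation (\<lambda>\<omega>. w k (S \<omega>))"
      unfolding T_distr by (rule integral_distr[OF S filling_measurable[OF w(1) k]])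
    finally show "N.expectation (\<lambda>\<omega>. quantile N (\<lambda>\<omega>. w k (T \<omega>)) (U \<omega>)) = \<alpha> k"
      using w(2) k by simp
  next
    have "AE \<omega> in distr N M fst. S \<omega> \<in> {0..1}" unfolding distr_fst by (rule S_supp)
    then have "AE \<omega> in N. S (fst \<omega>) \<in> {0..1}" by (rule AE_distrD[OF fst])
    moreover have "AE \<omega> in N. \<forall>k\<in>{1..n}. quantile N (\<lambda>\<omega>. w k (T \<omega>)) (U \<omega>) = w k (T \<omega>)"
      using Q by (intro AE_finite_allI) auto
    ultimately show "AE \<omega> in N. S (fst \<omega>) =
        (\<Sum>k=1..n. h k * quantile N (\<lambda>\<omega>. w k (T \<omega>)) (U \<omega>))"
    proof eventually_elim
      case (elim \<omega>)
      then show ?case using w(1) by (simp add: filling_def T_def)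
    qed
  qed
  then show ?thesis
    unfolding comonotonically_decomposable_def
    using enrich U X wk(2)
    by (intro exI[of _ N] exI[of _ U] exI[of _ "\<lambda>k \<omega>. w k (T \<omega>)"]) auto
qed

end

theorem theorem1:
  fixes M :: "'a measure" and S :: "'a \<Rightarrow> real"
    and n :: nat and h \<alpha> :: "nat \<Rightarrow> real"
  assumes n: "n \<ge> 2"
    and h_pos: "\<forall>k\<in>{1..n}. h k > 0"
    and h_sum: "(\<Sum>k=1..n. h k) = 1"
    and \<alpha>_le: "\<alpha> 1 \<le> 1"
    and \<alpha>_dec: "strict_antimono_on {1..n} \<alpha>"
    and \<alpha>_pos: "\<alpha> n > 0"
    and \<alpha>_half: "\<alpha> n \<le> 1 / 2"
    and M: "prob_space M"
    and S: "S \<in> borel_measurable M"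
    and S_supp: "AE \<omega> in M. S \<omega> \<in> {0..1}"
    and S_mean: "(LINT \<omega>|M. S \<omega>) = (\<Sum>k=1..n. h k * \<alpha> k)"
  shows
    "(decomposable M n h \<alpha> S \<longleftrightarrow>
        (\<forall>k\<in>{1..n-1}. stop_loss M S (partial_sum h k)
            \<le> (1 - partial_sum h k) * tail_mean n h \<alpha> k)) \<and>
     ((\<forall>k\<in>{1..n-1}. stop_loss M S (partial_sum h k)
            \<le> (1 - partial_sum h k) * tail_mean n h \<alpha> k) \<longleftrightarrow>
        convex_le M S (max_convex_space n \<alpha>) (max_convex_var h)) \<and>
     (convex_le M S (max_convex_space n \<alpha>) (max_convex_var h) \<longleftrightarrow>
        comonotonically_decomposable M n h \<alpha> S)"
proof -
  interpret decomposition_problem M S n h \<alpha>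
    using assms by (simp add: decomposition_problem_def decomposition_problem_axioms_def)
  show ?thesis
    unfolding stop_loss_bounded_iff[symmetric]
    using decomposable_imp_stop_loss_bounded stop_loss_bounded_imp_convex_le
      convex_le_imp_stop_loss_bounded comonotonically_decomposable_imp_decomposable
      stop_loss_bounded_imp_comonotonically_decomposable
    by blast
qed

end
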